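(* Let $(S,+)$ be a commutative semigroup, let $(y_{l,n})_{n\in\mathbb{Z}^\ast}\subseteq S$ for every $l\in\mathbb{Z}^\ast$, and let $\vec k=(k_n)_{n\in\mathbb{Z}^\ast}\subseteq\mathbb{N}$ be such that $(k_n)_{n\in\mathbb{N}}$ and $(k_{-n})_{n\in\mathbb{N}}$ are increasing sequences. Let $X$ be a nonempty compact metric space, $m\in\mathbb{N}$, and let $\{T_1^s\}_{s\in S},\ldots,\{T_m^s\}_{s\in S}$ be $m$ $\widetilde L(\Sigma,\vec k)$-systems of $S$ consisting of transformations of $X$, all contained in a commutative group $G$ of homeomorphisms of $X$. Then there exist $x_0\in X$ and, for every $n\in\mathbb{N}$, a function $s_n:\{1,\ldots,k_n\}\times\{1,\ldots,k_{-n}\}\to S$ of the form $$s_n(i,j)=\sum_{t\in C_n}y_{w_t,t}+\sum_{t\in V_n^+}y_{i,t}+\sum_{t\in V_n^-}y_{-j,t},$$ where $C_n=C_n^-\cup C_n^+\subseteq\mathbb{Z}^\ast$ with $\max C_{n+1}^-<\min C_n^-<\max C_n^+<\min C_{n+1}^+$, $V_n^+\subseteq\mathbb{N}$ with $\max V_n^+<\min V_{n+1}^+$ and $V_n^-\subseteq\mathbb{Z}^-$ with $\min V_n^->\max V_{n+1}^-$, such that $$R_1\text{-}\lim_{s\in FS[(s_n(i_n,j_n))_{n\in\mathbb{N}}]}T_i^s(x_0)=x_0\quad\text{for every }1\le i\le m,$$ uniformly for every $((i_n,j_n))_{n\in\mathbb{N}}\subseteq\mathbb{N}\times\mathbb{N}$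 with $1\le i_n\le k_n$, $1\le j_n\le k_{-n}$. Moreover, in case $(X,G)$ is minimal, the set of such points $x_0$ is a dense subset of $X$.
   Context: $\mathbb{N}=\{1,2,\ldots\}$, $\mathbb{Z}^-=\{-n:n\in\mathbb{N}\}$, $\mathbb{Z}^\ast=\mathbb{Z}\setminus\{0\}$. "Increasing" is in the weak sense. $(X,G)$ is minimal if no nonempty proper closed subset of $X$ is invariant under $G$. "Such points $x_0$" are those for which functions $s_n$ as described (depending on $x_0$) exist. Words and systems. $\Sigma=\{\alpha_n:n\in\mathbb{Z}^\ast\}$ with $\alpha_n=n$. $\widetilde L(\Sigma,\vec k)$ is the set of functions $w$ from a nonempty finite set $dom(w)\subset\mathbb{Z}^\ast$ to $\mathbb{Z}^\ast$ with $w(n)\in\{1,\ldots,k_n\}$ for $n\in dom(w)$, $n>0$, and $w(n)\in\{-k_n,\ldots,-1\}$ for $n\in dom(w)$, $n<0$. For words with disjoint domains, $w\star u$ is the word on $dom(w)\cup dom(u)$ extending both. $w<_{R_1}u$ means $dom(u)=A_1\cup A_2$ with $A_1,A_2\neq\emptyset$ and $\max A_1<\min dom(w)\le\max dom(w)<\min A_2$. Define $\varphi:\widetilde L(\Sigma,\vec k)\to S$ by $\varphi(w)=\sum_{n\in dom(w)}y_{w(n),n}$. A family $\{T^s\}_{s\in S}$ of continuous maps $X\to X$ is an $\widetilde L(\Sigma,\vec k)$-system of $S$ if $T^{\varphi(w_1)}T^{\varphi(w_2)}=T^{\varphi(w_1\star w_2)}$ for all $w_1<_{R_1}w_2$ in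 $\widetilde L(\Sigma,\vec k)$. In the claim, $C_n^-\subset\mathbb{Z}^-$, $C_n^+\subset\mathbb{N}$, $V_n^-$, $V_n^+$ are nonempty finite sets, with $C_n$ disjoint from $V_n^-\cup V_n^+$ (they are the constant positions and the negative/positive variable positions of a variable word), and for each $t\in C_n$ the letter $w_t$ is an integer with $w_t\in\{1,\ldots,k_t\}$ if $t>0$ and $w_t\in\{-k_t,\ldots,-1\}$ if $t<0$. $FS[(x_n)_n]$ is the set of finite sums $x_{n_1}+\cdots+x_{n_\lambda}$, $\lambda\in\mathbb{N}$, with $n_1<\cdots<n_\lambda$ in the index set. $R_1\text{-}\lim_{s\in FS[(s_n(i_n,j_n))_{n\in\mathbb{N}}]}x_s=x_0$ means: for every neighborhood $V$ of $x_0$ there is $n_0\in\mathbb{N}$ with $x_s\in V$ for every $s\in FS[(s_n(i_n,j_n))_{n\ge n_0}]$. Uniformly means that, for each $V$, one $n_0$ works for all admissible sequences $((i_n,j_n))_n$. *)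

theory Defs
  imports "HOL-Analysis.Analysis"
begin

text \<open>
  Conventions: \<open>\<nat>\<close> starts at 1, so a sequence indexed by it is a function on \<^typ>\<open>nat\<close> whose value at 0
  is never used; likewise families indexed by the nonzero integers are functions on \<^typ>\<open>int\<close> whose
  value at 0 is never used.
\<close>

subsection \<open>Finite sums in a commutative semigroup\<close>

text \<open>
  A semigroup need not have a zero, so \<^const>\<open>sum\<close> is not available. Here \<^const>\<open>None\<close> plays the role of
  the empty sum; only sums over nonempty finite sets are meaningful.
\<close>

definition sgsum :: "('i \<Rightarrow> 's::ab_semigroup_add) \<Rightarrow> 'i set \<Rightarrow> 's" where
  "sgsum f A =
     the (Finite_Set.fold (\<lambda>t acc. Some (case acc of None \<Rightarrow> f t | Some s \<Rightarrow> f t + s)) None A)"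

lemma comp_fun_commute_sgsum:
  fixes f :: "'i \<Rightarrow> 's::ab_semigroup_add"
  shows "comp_fun_commute (\<lambda>t acc. Some (case acc of None \<Rightarrow> f t | Some s \<Rightarrow> f t + s))"
  by unfold_locales (auto simp: fun_eq_iff ac_simps split: option.splits)

lemma sgsum_singleton: "sgsum f {a} = f a"
proof -
  interpret comp_fun_commute "\<lambda>t acc. Some (case acc of None \<Rightarrow> f t | Some s \<Rightarrow> f t + s)"
    by (rule comp_fun_commute_sgsum)
  show ?thesis by (simp add: sgsum_def)
qed

lemma sgsum_insert:
  assumes "finite A" "A \<noteq> {}" "a \<notin> A"
  shows "sgsum f (insert a A) = f a + sgsum f A"
proof -
  interpret comp_fun_commute "\<lambda>t acc. Some (case acc of None \<Rightarrow> f t | Some s \<Rightarrow> f t + s)"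
    by (rule comp_fun_commute_sgsum)
  obtain b B where "A = insert b B" "b \<notin> B"
    using assms(2) by (meson Set.set_insert ex_in_conv)
  with assms show ?thesis by (simp add: sgsum_def)
qed

text \<open>\<open>FS x I\<close> is the set of finite sums of \<open>x\<close> over distinct indices from \<open>I\<close>.\<close>

definition FS :: "(nat \<Rightarrow> 's::ab_semigroup_add) \<Rightarrow> nat set \<Rightarrow> 's set" where
  "FS x I = {sgsum x F | F. finite F \<and> F \<noteq> {} \<and> F \<subseteq> I}"

subsection \<open>Words\<close>

text \<open>
  A word is a partial map on the integers. The alphabet \<open>\<alpha>\<^sub>n = n\<close> is identified with the nonzero integers.
\<close>

definition admissible_letter :: "(int \<Rightarrow> nat) \<Rightarrow> int \<Rightarrow> int \<Rightarrow> bool" where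
  "admissible_letter k n a \<longleftrightarrow>
     (n > 0 \<and> a \<in> {1..int (k n)}) \<or> (n < 0 \<and> a \<in> {- int (k n)..-1})"

definition words :: "(int \<Rightarrow> nat) \<Rightarrow> (int \<rightharpoonup> int) set" where
  "words k = {w. finite (dom w) \<and> dom w \<noteq> {} \<and> 0 \<notin> dom w \<and>
                 (\<forall>n\<in>dom w. admissible_letter k n (the (w n)))}"

definition R1_less :: "(int \<rightharpoonup> int) \<Rightarrow> (int \<rightharpoonup> int) \<Rightarrow> bool" where
  "R1_less w u \<longleftrightarrow>
     (\<exists>A1 A2. dom u = A1 \<union> A2 \<and> A1 \<noteq> {} \<and> A2 \<noteq> {} \<and>
        Max A1 < Min (dom w) \<and> Min (dom w) \<le> Max (dom w) \<and> Max (dom w) < Min A2)"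

definition word_sum :: "(int \<Rightarrow> int \<Rightarrow> 's::ab_semigroup_add) \<Rightarrow> (int \<rightharpoonup> int) \<Rightarrow> 's" where
  "word_sum y w = sgsum (\<lambda>n. y (the (w n)) n) (dom w)"

text \<open>
  The concatenation of two words is \<open>++\<close>: words related by \<^const>\<open>R1_less\<close> have disjoint domains.
\<close>

definition word_system ::
  "(int \<Rightarrow> int \<Rightarrow> 's::ab_semigroup_add) \<Rightarrow> (int \<Rightarrow> nat) \<Rightarrow> ('s \<Rightarrow> 'x::topological_space \<Rightarrow> 'x) \<Rightarrow> bool"
  where
  "word_system y k T \<longleftrightarrow>
     (\<forall>s. continuous_on UNIV (T s)) \<and>
     (\<forall>w1\<in>words k. \<forall>w2\<in>words k. R1_less w1 w2 \<longrightarrow>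
        T (word_sum y w1) \<circ> T (word_sum y w2) = T (word_sum y (w1 ++ w2)))"

subsection \<open>Groups of homeomorphisms\<close>

definition comm_homeo_group :: "('x::topological_space \<Rightarrow> 'x) set \<Rightarrow> bool" where
  "comm_homeo_group G \<longleftrightarrow>
     id \<in> G \<and>
     (\<forall>f\<in>G. \<forall>g\<in>G. f \<circ> g \<in> G) \<and>
     (\<forall>f\<in>G. \<exists>g\<in>G. homeomorphism UNIV UNIV f g) \<and>
     (\<forall>f\<in>G. \<forall>g\<in>G. f \<circ> g = g \<circ> f)"

definition minimal_action :: "('x::topological_space \<Rightarrow> 'x) set \<Rightarrow> bool" where
  "minimal_action G \<longleftrightarrow>
     \<not> (\<exists>F. closed F \<and> F \<noteq> {} \<and> F \<noteq> UNIV \<and> (\<forall>g\<in>G. g ` F \<subseteq> F))"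

subsection \<open>Uniform recurrence\<close>

text \<open>
  The functions \<open>s\<^sub>n\<close> on \<open>{1..k\<^sub>n} \<times> {1..k\<^sub>-\<^sub>n}\<close>. The constant positions of
  different \<open>n\<close> are disjoint, so one family of letters \<open>w\<^sub>t\<close> serves all of them.
\<close>

definition variable_word_sums ::
  "(int \<Rightarrow> int \<Rightarrow> 's::ab_semigroup_add) \<Rightarrow> (int \<Rightarrow> nat) \<Rightarrow> (nat \<Rightarrow> nat \<Rightarrow> nat \<Rightarrow> 's) \<Rightarrow> bool"
  where
  "variable_word_sums y k s \<longleftrightarrow>
     (\<exists>(Cm :: nat \<Rightarrow> int set) (Cp :: nat \<Rightarrow> int set) (Vm :: nat \<Rightarrow> int set) (Vp :: nat \<Rightarrow> int set)
       (w :: int \<Rightarrow> int).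
       \<forall>n\<ge>1.
         finite (Cm n) \<and> Cm n \<noteq> {} \<and> Cm n \<subseteq> {..<0} \<and>
         finite (Cp n) \<and> Cp n \<noteq> {} \<and> Cp n \<subseteq> {0<..} \<and>
         finite (Vm n) \<and> Vm n \<noteq> {} \<and> Vm n \<subseteq> {..<0} \<and>
         finite (Vp n) \<and> Vp n \<noteq> {} \<and> Vp n \<subseteq> {0<..} \<and>
         (Cm n \<union> Cp n) \<inter> (Vm n \<union> Vp n) = {} \<and>
         (\<forall>t\<in>Cm n \<union> Cp n. admissible_letter k t (w t)) \<and>
         Max (Cm (n + 1)) < Min (Cm n) \<and> Min (Cm n) < Max (Cp n) \<and> Max (Cp n) < Min (Cp (n + 1)) \<and>
         Max (Vp n) < Min (Vp (n + 1)) \<and>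
         Max (Vm (n + 1)) < Min (Vm n) \<and>
         (\<forall>i\<in>{1..k (int n)}. \<forall>j\<in>{1..k (- int n)}.
            s n i j = sgsum (\<lambda>t. y (w t) t) (Cm n \<union> Cp n)
                      + sgsum (\<lambda>t. y (int i) t) (Vp n)
                      + sgsum (\<lambda>t. y (- int j) t) (Vm n)))"

definition choice_sequences ::
  "(int \<Rightarrow> nat) \<Rightarrow> (nat \<Rightarrow> nat \<Rightarrow> nat \<Rightarrow> 's) \<Rightarrow> (nat \<Rightarrow> 's) set" where
  "choice_sequences k s =
     {(\<lambda>n. s n (i n) (j n)) | i j.
        \<forall>n\<ge>1. i n \<in> {1..k (int n)} \<and> j n \<in> {1..k (- int n)}}"

text \<open>
  \<open>R1_lim_uniformly A f l\<close>: the limit of \<open>f s\<close> along \<open>s\<close> in \<open>FS x\<close> is \<open>l\<close>, uniformly for the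
  sequences \<open>x\<close> in \<open>A\<close>.
\<close>

definition R1_lim_uniformly ::
  "(nat \<Rightarrow> 's::ab_semigroup_add) set \<Rightarrow> ('s \<Rightarrow> 'x::topological_space) \<Rightarrow> 'x \<Rightarrow> bool" where
  "R1_lim_uniformly A f l \<longleftrightarrow>
     (\<forall>V. open V \<and> l \<in> V \<longrightarrow> (\<exists>n0\<ge>1. \<forall>x\<in>A. \<forall>s\<in>FS x {n0..}. f s \<in> V))"

definition R1_recurrent_points ::
  "(int \<Rightarrow> int \<Rightarrow> 's::ab_semigroup_add) \<Rightarrow> (int \<Rightarrow> nat) \<Rightarrow> nat \<Rightarrow>
   (nat \<Rightarrow> 's \<Rightarrow> 'x::topological_space \<Rightarrow> 'x) \<Rightarrow> 'x set" where
  "R1_recurrent_points y k m T =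
     {x0. \<exists>s. variable_word_sums y k s \<and>
              (\<forall>l\<in>{1..m}. R1_lim_uniformly (choice_sequences k s) (\<lambda>s. T l s x0) x0)}"

end

theory Submission
  imports Defs
begin

text \<open>
  All transformations commute, so it suffices to use the variable words whose constants are \<open>\<plusminus>1\<close> at
  \<open>\<plusminus>(2 * t + 1)\<close> and whose variables sit at \<open>\<plusminus>2 * t\<close>, for \<open>t\<close> in a finite set \<open>F\<close>: for each system and
  each choice of \<open>i\<close> and \<open>j\<close> the transformation is then an IP system in \<open>F\<close>. By topological multiple recurrence
  for finitely many commuting IP systems on a minimal set \<open>M\<close>, every open \<open>U\<close> meeting \<open>M\<close> admits arbitrarily
  late \<open>F\<close> and a point of \<open>U \<inter> M\<close> that all of them keep in \<open>U\<close>. Iterating gives shrinking open sets \<open>V n\<close>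
  such that the transformations of stage \<open>n + 1\<close> map \<open>V (n + 1)\<close> into \<open>V n\<close>; the point in all
  of them is uniformly recurrent. Starting inside any given open set, with \<open>M\<close> the whole space,
  gives density.
\<close>

subsection \<open>Finite sums\<close>

lemma sgsum_cong:
  assumes "finite A" "A \<noteq> {}" "\<And>t. t \<in> A \<Longrightarrow> f t = g t"
  shows "sgsum f A = sgsum g A"
  using assms by (induction A rule: finite_ne_induct) (auto simp: sgsum_singleton sgsum_insert)

lemma sgsum_Un_disjoint:
  assumes "finite A" "A \<noteq> {}" "finite B" "B \<noteq> {}" "A \<inter> B = {}"
  shows "sgsum f (A \<union> B) = sgsum f A + sgsum f B"
  using assms
  by (induction A rule: finite_ne_induct) (auto simp: sgsum_singleton sgsum_insert add.assoc)

subsection \<open>Minimal sets\<close>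

definition minimal_set :: "('x::topological_space \<Rightarrow> 'x) set \<Rightarrow> 'x set \<Rightarrow> bool" where
  "minimal_set G M \<longleftrightarrow>
     closed M \<and> M \<noteq> {} \<and> (\<forall>g\<in>G. g ` M \<subseteq> M) \<and>
     (\<forall>C\<subseteq>M. closed C \<and> C \<noteq> {} \<and> (\<forall>g\<in>G. g ` C \<subseteq> C) \<longrightarrow> C = M)"

lemma minimal_set_UNIV: "minimal_action G \<Longrightarrow> minimal_set G UNIV"
  by (auto simp: minimal_action_def minimal_set_def)

text \<open>Zorn's lemma is applied to complements: a maximal proper open \<open>C\<close> that
  contains its preimages under all \<open>g\<close> in \<open>G\<close> is the complement of a
  minimal set. Compactness keeps the union of a chain proper.\<close>

lemma minimal_set_exists:
  fixes G :: "('x::topological_space \<Rightarrow> 'x) set"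
  assumes "compact (UNIV :: 'x set)"
  shows "\<exists>M. minimal_set G M"
proof -
  define A where "A = {C :: 'x set. open C \<and> C \<noteq> UNIV \<and> (\<forall>g\<in>G. g -` C \<subseteq> C)}"
  have "\<Union>\<C> \<in> A" if chain: "subset.chain A \<C>" for \<C>
  proof -
    have sub: "\<C> \<subseteq> A"
      using chain by (simp add: subset.chain_def)
    have "\<Union>\<C> \<noteq> UNIV"
    proof
      assume "\<Union>\<C> = UNIV"
      then have "UNIV \<subseteq> \<Union>\<C>" by simp
      moreover have "open C" if "C \<in> \<C>" for C
        using that sub by (auto simp: A_def)
      ultimately obtain \<D> where D: "\<D> \<subseteq> \<C>" "finite \<D>" "UNIV \<subseteq> \<Union>\<D>"
        by (rule compactE[OF assms])
      then have "\<D> \<noteq> {}" by auto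
      moreover have "subset.chain A \<D>"
        using chain D(1) unfolding subset.chain_def by blast
      \<comment> \<open>A finite nonempty subfamily of a chain contains its own union, so the finite
        subcover would put the whole space into \<open>A\<close>.\<close>
      ultimately have "\<Union>\<D> \<in> \<D>"
        using D(2) by (intro Union_in_chain)
      then show False
        using D sub by (auto simp: A_def)
    qed
    moreover have "open (\<Union>\<C>)"
      using sub by (auto simp: A_def)
    moreover have "g -` B \<subseteq> B" if "g \<in> G" "B \<in> \<C>" for g B
      using that sub by (auto simp: A_def)
    then have "\<forall>g\<in>G. g -` \<Union>\<C> \<subseteq> \<Union>\<C>"
      by blast
    ultimately show ?thesis
      by (simp add: A_def)
  qed
  then obtain C where C: "C \<in> A" and max: "\<And>B. B \<in> A \<Longrightarrow> C \<subseteq> B \<Longrightarrow> B = C"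
    using subset_Zorn'[of A] by blast
  have "minimal_set G (- C)"
    unfolding minimal_set_def
  proof (intro conjI allI impI)
    fix K assume K: "K \<subseteq> - C" "closed K \<and> K \<noteq> {} \<and> (\<forall>g\<in>G. g ` K \<subseteq> K)"
    then have "- K \<in> A" by (auto simp: A_def)
    then show "K = - C" using max[of "- K"] K by auto
  qed (use C in \<open>auto simp: A_def\<close>)
  then show ?thesis ..
qed

section \<open>Commutative homeomorphism groups and covers by translates\<close>

lemma comm_homeo_groupD:
  assumes "comm_homeo_group G"
  shows "id \<in> G"
    and "f \<in> G \<Longrightarrow> g \<in> G \<Longrightarrow> f \<circ> g \<in> G"
    and "f \<in> G \<Longrightarrow> g \<in> G \<Longrightarrow> f (g x) = g (f x)"
    and "f \<in> G \<Longrightarrow> continuous_on UNIV f"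
    and "f \<in> G \<Longrightarrow> bij f"
    and "f \<in> G \<Longrightarrow> inv f \<in> G"
proof -
  show "id \<in> G" and "f \<in> G \<Longrightarrow> g \<in> G \<Longrightarrow> f \<circ> g \<in> G"
    using assms by (auto simp: comm_homeo_group_def)
  show "f (g x) = g (f x)" if "f \<in> G" "g \<in> G"
    using assms that unfolding comm_homeo_group_def by (metis comp_apply)
  assume "f \<in> G"
  then obtain g where g: "g \<in> G" "homeomorphism UNIV UNIV f g"
    using assms by (auto simp: comm_homeo_group_def)
  show "continuous_on UNIV f"
    using g by (simp add: homeomorphism_def)
  have fg: "g (f x) = x" "f (g x) = x" for x
    using g by (auto simp: homeomorphism_def)
  then show "bij f"
    by (intro o_bij[of g]) (auto simp: fun_eq_iff)
  have "inv f = g"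
    using fg by (intro inv_equality)
  then show "inv f \<in> G"
    using g by simp
qed

text \<open>The points of \<open>M\<close> whose entire \<open>G\<close>-orbit misses
  \<open>U\<close> form a closed invariant set. It is proper in \<open>M\<close>, as
  \<open>id\<close> lies in \<open>G\<close> and \<open>U\<close> meets \<open>M\<close>, hence
  empty by minimality. Compactness of \<open>M\<close> then leaves finitely many translates.\<close>

lemma minimal_set_finite_cover:
  fixes G :: "('x::topological_space \<Rightarrow> 'x) set"
  assumes cpt: "compact (UNIV :: 'x set)" and G: "comm_homeo_group G"
    and M: "minimal_set G M" and U: "open U" "U \<inter> M \<noteq> {}"
  shows "\<exists>R\<subseteq>G. finite R \<and> M \<subseteq> (\<Union>r\<in>R. r -` U)"
proof -
  note GD = comm_homeo_groupD[OF G]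
  have opn: "open (r -` U)" if "r \<in> G" for r
    using open_vimage[OF U(1) GD(4)[OF that]] .
  define K where "K = M - (\<Union>r\<in>G. r -` U)"
  have "closed M"
    using M by (simp add: minimal_set_def)
  then have "closed K"
    unfolding K_def using opn by (intro closed_Diff open_UN ballI)
  moreover have "g ` K \<subseteq> K" if g: "g \<in> G" for g
  proof -
    have "g x \<notin> r -` U" if "x \<in> K" "r \<in> G" for x r
    proof
      assume "g x \<in> r -` U"
      then have "x \<in> (r \<circ> g) -` U" by simp
      then show False
        using that GD(2)[OF \<open>r \<in> G\<close> g] unfolding K_def by blast
    qed
    moreover have "g ` M \<subseteq> M"
      using M g by (simp add: minimal_set_def)
    ultimately show ?thesis
      unfolding K_def by blast
  qed
  moreover have "K \<noteq> M"
  proof -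
    obtain x where "x \<in> U" "x \<in> M" using U(2) by blast
    then have "x \<in> id -` U" by simp
    then have "x \<notin> K" unfolding K_def using GD(1) by blast
    then show ?thesis using \<open>x \<in> M\<close> by blast
  qed
  moreover have "K \<subseteq> M"
    by (auto simp: K_def)
  ultimately have "K = {}"
    using M unfolding minimal_set_def by metis
  then have "M \<subseteq> (\<Union>r\<in>G. r -` U)"
    by (auto simp: K_def)
  moreover have "compact M"
    using M cpt closed_Int_compact[of M UNIV] by (simp add: minimal_set_def)
  ultimately obtain R where "R \<subseteq> G" "finite R" "M \<subseteq> (\<Union>r\<in>R. r -` U)"
    using compactE_image[of M G "\<lambda>r. r -` U"] opn by blast
  then show ?thesis by blast
qed

subsection \<open>IP systems of commuting homeomorphisms\<close>

text \<open>Multiplicativity is asked only for \<open>A\<close> lying entirely before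
  \<open>B\<close>, the situation in which block words are related by \<open>R1_less\<close>. The
  threshold \<open>N\<close> leaves room for an index from which the chosen letters are
  admissible.\<close>

definition ip_system :: "('x \<Rightarrow> 'x) set \<Rightarrow> nat \<Rightarrow> (nat set \<Rightarrow> 'x \<Rightarrow> 'x) \<Rightarrow> bool" where
  "ip_system G N P \<longleftrightarrow>
     (\<forall>A. P A \<in> G) \<and>
     (\<forall>A B. finite A \<and> A \<noteq> {} \<and> finite B \<and> B \<noteq> {} \<and> A \<subseteq> {N..} \<and> B \<subseteq> {N..} \<and>
        (\<forall>a\<in>A. \<forall>b\<in>B. a < b) \<longrightarrow> P (A \<union> B) = P A \<circ> P B)"

lemma ip_system_Un:
  assumes "ip_system G N P" "finite A" "A \<noteq> {}" "finite B" "B \<noteq> {}" "A \<subseteq> {N..}" "B \<subseteq> {N..}"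
    and "\<And>a b. a \<in> A \<Longrightarrow> b \<in> B \<Longrightarrow> a < b"
  shows "P (A \<union> B) = P A \<circ> P B"
  using assms unfolding ip_system_def by simp

lemma ip_system_mono:
  assumes "ip_system G N P" "N \<le> N'"
  shows "ip_system G N' P"
  unfolding ip_system_def
proof (intro conjI allI impI)
  show "P A \<in> G" for A
    using assms(1) by (simp add: ip_system_def)
  have sub: "{N'..} \<subseteq> {N..}"
    using assms(2) by simp
  show "P (A \<union> B) = P A \<circ> P B"
    if "finite A \<and> A \<noteq> {} \<and> finite B \<and> B \<noteq> {} \<and> A \<subseteq> {N'..} \<and> B \<subseteq> {N'..} \<and> (\<forall>a\<in>A. \<forall>b\<in>B. a < b)"
    for A B
  proof (rule ip_system_Un[OF assms(1)])
    show "A \<subseteq> {N..}" "B \<subseteq> {N..}"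
      using that sub by (meson subset_trans)+
  qed (use that in simp_all)
qed

text \<open>Since \<open>G\<close> is commutative, \<open>inv (Q A)\<close> can be moved past
  \<open>P B\<close> and \<open>inv (Q B)\<close>. Such quotients reduce the number of systems by
  one in the recurrence theorem.\<close>

lemma ip_system_quotient:
  assumes G: "comm_homeo_group G" and P: "ip_system G N P" and Q: "ip_system G N Q"
  shows "ip_system G N (\<lambda>A. P A \<circ> inv (Q A))"
proof -
  note GD = comm_homeo_groupD[OF G]
  have mem: "P A \<in> G" "Q A \<in> G" "inv (Q A) \<in> G" for A
    using P Q GD(6) by (auto simp: ip_system_def)
  have "P (A \<union> B) \<circ> inv (Q (A \<union> B)) = P A \<circ> inv (Q A) \<circ> (P B \<circ> inv (Q B))"
    if "P (A \<union> B) = P A \<circ> P B" "Q (A \<union> B) = Q A \<circ> Q B" for A B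
  proof -
    have "inv (Q A \<circ> Q B) = inv (Q B) \<circ> inv (Q A)"
      using GD(5) mem by (intro o_inv_distrib) auto
    moreover have "P B (inv (Q B) (inv (Q A) x)) = inv (Q A) (P B (inv (Q B) x))" for x
      using GD(3) mem by metis
    ultimately show ?thesis
      unfolding that by (simp add: fun_eq_iff)
  qed
  moreover have "P A \<circ> inv (Q A) \<in> G" for A
    using GD(2) mem by blast
  ultimately show ?thesis
    using P Q unfolding ip_system_def by simp
qed

lemma consecutive_less:
  fixes F :: "nat \<Rightarrow> nat set"
  assumes "\<And>n. F n \<noteq> {}" "\<And>n t t'. t \<in> F n \<Longrightarrow> t' \<in> F (Suc n) \<Longrightarrow> t < t'"
    and "n < n'" "t \<in> F n" "t' \<in> F n'"
  shows "t < t'"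
  using assms(3,5)
proof (induction n' arbitrary: t')
  case (Suc n')
  obtain u where u: "u \<in> F n'" using assms(1) by blast
  have "t < u \<or> n = n'" using Suc u by (cases "n = n'") auto
  then show ?case
    using assms(2)[OF u Suc.prems(2)] assms(2,4) Suc.prems(2) less_trans by blast
qed simp

text \<open>Telescoping: the block with the largest index acts first, so \<open>F (j - 1)\<close>
  takes \<open>V j\<close> to \<open>V (j - 1)\<close>, and the earlier blocks carry the point on
  down to \<open>V i\<close>.\<close>

lemma ip_system_interval:
  assumes P: "ip_system G N P"
    and F: "\<And>n. finite (F n)" "\<And>n. F n \<noteq> {}" "\<And>n. F n \<subseteq> {N..}"
    and less: "\<And>n n' t t'. n < n' \<Longrightarrow> t \<in> F n \<Longrightarrow> t' \<in> F n' \<Longrightarrow> t < t'"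
    and V: "\<And>n x. x \<in> V (Suc n) \<Longrightarrow> P (F n) x \<in> V n"
    and "i < j" "x \<in> V j"
  shows "P (\<Union>n\<in>{i..<j}. F n) x \<in> V i"
  using \<open>i < j\<close> \<open>x \<in> V j\<close>
proof (induction j arbitrary: x)
  case (Suc j)
  show ?case
  proof (cases "i = j")
    case True
    then show ?thesis using Suc V by simp
  next
    case False
    then have ij: "i < j" using Suc.prems by simp
    have "P ((\<Union>n\<in>{i..<j}. F n) \<union> F j) = P (\<Union>n\<in>{i..<j}. F n) \<circ> P (F j)"
    proof (rule ip_system_Un[OF P])
      show "(\<Union>n\<in>{i..<j}. F n) \<noteq> {}" using ij F(2) by auto
      show "(\<Union>n\<in>{i..<j}. F n) \<subseteq> {N..}" using F(3) by blast
      show "a < b" if "a \<in> (\<Union>n\<in>{i..<j}. F n)" "b \<in> F j" for a b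
        using that less by auto
    qed (simp_all add: F)
    moreover have "(\<Union>n\<in>{i..<Suc j}. F n) = (\<Union>n\<in>{i..<j}. F n) \<union> F j"
      using ij by (simp add: atLeastLessThanSuc Un_commute)
    ultimately show ?thesis
      using Suc.IH[OF ij V] Suc.prems by simp
  qed
qed simp

text \<open>
  Colour focusing: dividing by the last system \<open>P c\<close> reduces the induction step to the smaller family,
  and translates \<open>r -` U\<close> covering \<open>M\<close> serve as colours of the focusing sets \<open>V n\<close>.
\<close>

lemma ip_recurrence:
  fixes G :: "('x::topological_space \<Rightarrow> 'x) set"
  assumes cpt: "compact (UNIV :: 'x set)" and G: "comm_homeo_group G" and M: "minimal_set G M"
    and "finite I" "\<And>a. a \<in> I \<Longrightarrow> ip_system G N (P a)" "open U" "U \<inter> M \<noteq> {}"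
  shows "\<exists>F. finite F \<and> F \<noteq> {} \<and> F \<subseteq> {N..} \<and> (\<exists>x\<in>U \<inter> M. \<forall>a\<in>I. P a F x \<in> U)"
  using assms(4-)
proof (induction I arbitrary: N P U rule: finite_induct)
  case empty
  then show ?case by (intro exI[of _ "{N}"]) auto
next
  case (insert c I)
  note GD = comm_homeo_groupD[OF G]
  have inG: "P a F \<in> G" if "a \<in> insert c I" for a F
    using insert.prems(1)[OF that] by (auto simp: ip_system_def)
  have GM: "g x \<in> M" if "g \<in> G" "x \<in> M" for g x
    using M that by (auto simp: minimal_set_def)
  obtain R where R: "R \<subseteq> G" "finite R" "M \<subseteq> (\<Union>r\<in>R. r -` U)"
    using minimal_set_finite_cover[OF cpt G M insert.prems(2,3)] by blast
  \<comment> \<open>One focusing step: beyond any bound \<open>L\<close> there is a block under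
    which every system maps some open \<open>V'\<close> into \<open>V\<close>, where
    \<open>V'\<close> has a single colour \<open>r\<close>.\<close>
  have step: "\<exists>F V' r. finite F \<and> F \<noteq> {} \<and> F \<subseteq> {L..} \<and> open V' \<and> V' \<inter> M \<noteq> {} \<and> r \<in> R \<and>
      V' \<subseteq> r -` U \<and> (\<forall>a\<in>insert c I. \<forall>x\<in>V'. P a F x \<in> V)"
    if V: "open V" "V \<inter> M \<noteq> {}" and L: "N \<le> L" for V L
  proof -
    let ?Q = "\<lambda>a A. P a A \<circ> inv (P c A)"
    have "ip_system G L (?Q a)" if "a \<in> I" for a
      using that L insert.prems(1) by (intro ip_system_quotient[OF G] ip_system_mono[OF _ L]) auto
    then have "\<exists>F. finite F \<and> F \<noteq> {} \<and> F \<subseteq> {L..} \<and> (\<exists>x\<in>V \<inter> M. \<forall>a\<in>I. ?Q a F x \<in> V)"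
      using V by (intro insert.IH)
    then obtain F x where F: "finite F" "F \<noteq> {}" "F \<subseteq> {L..}"
      and x: "x \<in> V \<inter> M" "\<And>a. a \<in> I \<Longrightarrow> P a F (inv (P c F) x) \<in> V"
      unfolding comp_apply by blast
    \<comment> \<open>Pulling \<open>x\<close> back by \<open>P c F\<close> turns the quotients at
      \<open>x\<close> into \<open>P a F z\<close> and gives \<open>P c F z = x\<close>, so the
      added system \<open>c\<close> also leads into \<open>V\<close>.\<close>
    define z where "z = inv (P c F) x"
    have "P c F z = x"
      unfolding z_def using inG GD(5) by (simp add: bij_is_surj surj_f_inv_f)
    then have zV: "P a F z \<in> V" if "a \<in> insert c I" for a
      using that x by (auto simp: z_def)
    have z: "z \<in> M"
      using x(1) GM GD(6)[OF inG] by (simp add: z_def)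
    obtain r where r: "r \<in> R" "r z \<in> U"
      using R(3) z by auto
    define V' where "V' = r -` U \<inter> (\<Inter>a\<in>insert c I. P a F -` V)"
    have "open V'"
      unfolding V'_def using insert.hyps(1) insert.prems(2) V(1) r(1) R(1) GD(4) inG
      by (intro open_Int open_INT open_vimage ballI) auto
    moreover have "V' \<inter> M \<noteq> {}" using z zV r by (auto simp: V'_def)
    ultimately show ?thesis
      using F r(1) by (intro exI[of _ F] exI[of _ V'] exI[of _ r]) (simp add: V'_def)
  qed
  \<comment> \<open>The sequence built below carries triples of a block, an open focusing set and
    its colour; \<open>nxt\<close> says that the new block comes later and maps the new set into the
    old one.\<close>
  define good where "good = (\<lambda>(F :: nat set, V, r). finite F \<and> F \<noteq> {} \<and> F \<subseteq> {N..} \<and>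
      open V \<and> V \<inter> M \<noteq> {} \<and> r \<in> R \<and> V \<subseteq> r -` U)"
  define nxt where "nxt = (\<lambda>(F :: nat set, V, r :: 'x \<Rightarrow> 'x) (F', V', r' :: 'x \<Rightarrow> 'x).
      (\<forall>t\<in>F. \<forall>t'\<in>F'. t < t') \<and> (\<forall>a\<in>insert c I. \<forall>x\<in>V'. P a F' x \<in> V))"
  have "\<exists>f. \<forall>n. good (f n) \<and> nxt (f n) (f (Suc n))"
  proof (rule dependent_nat_choice)
    show "\<exists>q. good q"
      using step[of UNIV N] M by (auto simp: good_def minimal_set_def)
  next
    fix q n assume q: "good q"
    obtain F V r where [simp]: "q = (F, V, r)" by (cases q)
    have "F \<noteq> {}" "finite F" "F \<subseteq> {N..}" "open V" "V \<inter> M \<noteq> {}"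
      using q by (auto simp: good_def)
    then have "Max F \<in> {N..}"
      using Max_in[of F] by blast
    then have "N \<le> Suc (Max F)" by simp
    from step[OF \<open>open V\<close> \<open>V \<inter> M \<noteq> {}\<close> this] obtain F' V' r' where
      F': "finite F'" "F' \<noteq> {}" "F' \<subseteq> {Suc (Max F)..}" "open V'" "V' \<inter> M \<noteq> {}" "r' \<in> R"
      "V' \<subseteq> r' -` U" "\<forall>a\<in>insert c I. \<forall>x\<in>V'. P a F' x \<in> V"
      by blast
    have "\<forall>t\<in>F. \<forall>t'\<in>F'. t < t'"
      using F'(3) Max_ge[OF \<open>finite F\<close>] by (fastforce simp: Suc_le_eq)
    moreover have "F' \<subseteq> {N..}"
      using F'(3) \<open>N \<le> Suc (Max F)\<close> by auto
    ultimately have "good (F', V', r') \<and> nxt q (F', V', r')"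
      using F' by (simp add: good_def nxt_def)
    then show "\<exists>q'. good q' \<and> nxt q q'" ..
  qed
  then obtain f where f: "\<And>n. good (f n)" "\<And>n. nxt (f n) (f (Suc n))" by blast
  define F V r where "F = (\<lambda>n. fst (f n))" and "V = (\<lambda>n. fst (snd (f n)))"
    and "r = (\<lambda>n. snd (snd (f n)))"
  have fn: "f n = (F n, V n, r n)" for n
    by (simp add: F_def V_def r_def)
  have F: "finite (F n)" "F n \<noteq> {}" "F n \<subseteq> {N..}" and V: "V n \<inter> M \<noteq> {}"
    and r: "r n \<in> R" "V n \<subseteq> r n -` U" for n
    using f(1)[of n] by (auto simp: good_def fn)
  have F_Suc: "t < t'" if "t \<in> F n" "t' \<in> F (Suc n)" for n t t'
    using f(2)[of n] that by (auto simp: nxt_def fn)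
  have V_Suc: "P a (F (Suc n)) x \<in> V n" if "a \<in> insert c I" "x \<in> V (Suc n)" for a n x
    using f(2)[of n] that by (auto simp: nxt_def fn)
  \<comment> \<open>Pigeonhole: the finitely many colours in \<open>R\<close> serve infinitely many
    stages, so two stages share one.\<close>
  have "\<not> inj r"
    using r(1) \<open>finite R\<close> by (meson finite_imageD finite_subset image_subsetI infinite_UNIV_nat)
  then obtain i j where ij: "i < j" "r i = r j"
    by (metis injI linorder_neqE_nat)
  \<comment> \<open>The block leading from \<open>V (Suc n)\<close> to \<open>V n\<close> carries
    the index \<open>Suc n\<close>, so \<open>H\<close> collects the blocks \<open>i + 1\<close> to
    \<open>j\<close>.\<close>
  define H where "H = (\<Union>n\<in>{i..<j}. F (Suc n))"
  obtain z where z: "z \<in> V j" "z \<in> M" using V by blast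
  have PH: "P a H z \<in> V i" if a: "a \<in> insert c I" for a
    unfolding H_def
  proof (rule ip_system_interval[where P = "P a" and N = N and F = "\<lambda>n. F (Suc n)" and V = V])
    show "t < t'" if "n < n'" "t \<in> F (Suc n)" "t' \<in> F (Suc n')" for n n' t t'
      by (rule consecutive_less[of F, OF F(2) F_Suc _ that(2,3)]) (use that(1) in simp_all)
    show "P a (F (Suc n)) x \<in> V n" if "x \<in> V (Suc n)" for n x
      by (rule V_Suc[OF a that])
  qed (fact F ij(1) z(1) insert.prems(1)[OF a])+
  \<comment> \<open>The recurrent point is the translate \<open>r j z\<close>: commutativity moves
    \<open>r j\<close> outside, and \<open>r j = r i\<close> sends \<open>V i\<close> into
    \<open>U\<close>.\<close>
  have "P a H (r j z) \<in> U" if a: "a \<in> insert c I" for a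
  proof -
    have "r j \<in> G" "P a H z \<in> V i" using r(1) R(1) PH[OF a] by auto
    then have "r j (P a H z) \<in> U" using r(2)[of i] ij(2) by auto
    then show ?thesis
      using GD(3)[OF inG[OF a] \<open>r j \<in> G\<close>] by simp
  qed
  moreover have "r j z \<in> U \<inter> M"
    using r z GM R(1) by blast
  moreover have "finite H" "H \<noteq> {}" "H \<subseteq> {N..}"
    using F ij(1) by (auto simp: H_def)
  ultimately show ?case by blast
qed

subsection \<open>Block words\<close>

definition pos_consts :: "nat set \<Rightarrow> int set" where "pos_consts F = (\<lambda>t. 2 * int t + 1) ` F"
definition neg_consts :: "nat set \<Rightarrow> int set" where "neg_consts F = (\<lambda>t. - 2 * int t - 1) ` F"
definition pos_vars :: "nat set \<Rightarrow> int set" where "pos_vars F = (\<lambda>t. 2 * int t) ` F"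
definition neg_vars :: "nat set \<Rightarrow> int set" where "neg_vars F = (\<lambda>t. - 2 * int t) ` F"

definition positions :: "nat set \<Rightarrow> int set" where
  "positions F = neg_consts F \<union> pos_consts F \<union> pos_vars F \<union> neg_vars F"

text \<open>\<open>a\<close> and \<open>b\<close> depend on \<open>t\<close> instead of being single
  letters, so that a sum over blocks with different choices is again given by one block
  word.\<close>

definition block_letter :: "(nat \<Rightarrow> nat) \<Rightarrow> (nat \<Rightarrow> nat) \<Rightarrow> int \<Rightarrow> int" where
  "block_letter a b p =
     (if odd p then sgn p
      else if p > 0 then int (a (nat p div 2)) else - int (b (nat (- p) div 2)))"

text \<open>
  The word with constant letters \<open>\<plusminus>1\<close> at \<open>\<plusminus>(2 * t + 1)\<close>, and the letters \<open>a t\<close> and \<open>- b t\<close> substituted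
  for the variables at \<open>2 * t\<close> and \<open>- 2 * t\<close>, for \<open>t \<in> F\<close>.
\<close>

definition block_word :: "(nat \<Rightarrow> nat) \<Rightarrow> (nat \<Rightarrow> nat) \<Rightarrow> nat set \<Rightarrow> (int \<rightharpoonup> int)" where
  "block_word a b F = (\<lambda>p. if p \<in> positions F then Some (block_letter a b p) else None)"

lemmas position_defs = neg_consts_def pos_consts_def pos_vars_def neg_vars_def

lemma finite_positions [simp]: "finite F \<Longrightarrow> finite (positions F)"
  by (simp add: positions_def position_defs)

lemma positions_empty_iff [simp]: "positions F = {} \<longleftrightarrow> F = {}"
  by (simp add: positions_def position_defs)

lemma positions_Un: "positions (A \<union> B) = positions A \<union> positions B"
  by (auto simp: positions_def position_defs)

text \<open>Each integer belongs to exactly one \<open>t\<close>, half its absolute value rounded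
  down, so disjoint index sets give disjoint sets of positions.\<close>

lemma positions_eq: "positions F = {p. nat \<bar>p\<bar> div 2 \<in> F}"
proof (intro set_eqI iffI)
  fix p assume "p \<in> positions F"
  then show "p \<in> {p. nat \<bar>p\<bar> div 2 \<in> F}"
    by (auto simp: positions_def position_defs nat_add_distrib nat_mult_distrib abs_if nat_diff_distrib)
next
  fix p assume p: "p \<in> {p. nat \<bar>p\<bar> div 2 \<in> F}"
  define t where "t = nat \<bar>p\<bar> div 2"
  have "p = 2 * int t + 1 \<or> p = - 2 * int t - 1 \<or> p = 2 * int t \<or> p = - 2 * int t"
    unfolding t_def by linarith
  then show "p \<in> positions F"
    using p by (auto simp: t_def[symmetric] positions_def position_defs)
qed

lemma dom_block_word [simp]: "dom (block_word a b F) = positions F"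
  by (auto simp: block_word_def split: if_splits)

text \<open>The letter is determined by the position alone, so the two words agree on any
  overlap.\<close>

lemma block_word_Un: "block_word a b A ++ block_word a b B = block_word a b (A \<union> B)"
  by (auto simp: block_word_def map_add_def positions_Un fun_eq_iff)

section \<open>Semigroup sums along block words\<close>

lemma word_sum_block_word:
  assumes "finite F" "F \<noteq> {}"
  shows "word_sum y (block_word a b F) = sgsum (\<lambda>p. y (block_letter a b p) p) (positions F)"
  unfolding word_sum_def dom_block_word using assms by (intro sgsum_cong) (auto simp: block_word_def)

lemma word_sum_block_word_Un:
  assumes "finite A" "A \<noteq> {}" "finite B" "B \<noteq> {}" "A \<inter> B = {}"
  shows "word_sum y (block_word a b (A \<union> B)) =
    word_sum y (block_word a b A) + word_sum y (block_word a b B)"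
proof -
  have "positions A \<inter> positions B = {}"
    using assms(5) by (auto simp: positions_eq)
  then show ?thesis
    using assms by (simp add: word_sum_block_word positions_Un sgsum_Un_disjoint)
qed

lemma word_sum_block_word_cong:
  assumes "finite F" "F \<noteq> {}" "F \<subseteq> {1..}" "\<And>t. t \<in> F \<Longrightarrow> a t = a' t \<and> b t = b' t"
  shows "word_sum y (block_word a b F) = word_sum y (block_word a' b' F)"
proof -
  have "block_letter a b p = block_letter a' b' p" if "p \<in> positions F" for p
    using that assms(4) by (auto simp: positions_eq block_letter_def abs_if split: if_splits)
  then show ?thesis
    using assms by (auto simp: word_sum_block_word intro!: sgsum_cong)
qed

text \<open>Sums of stage values with separate choices \<open>i h\<close> and \<open>j h\<close>
  become a single word sum, to which the system law can be applied.\<close>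

lemma word_sum_block_word_UN:
  assumes "finite H" "H \<noteq> {}" "\<And>h. finite (F h)" "\<And>h. F h \<noteq> {}"
    and "\<And>h. h \<in> H \<Longrightarrow> F h \<subseteq> {1..}"
    and "\<And>h h'. h \<noteq> h' \<Longrightarrow> F h \<inter> F h' = {}"
    and "\<And>h t. h \<in> H \<Longrightarrow> t \<in> F h \<Longrightarrow> a t = i h \<and> b t = j h"
  shows "sgsum (\<lambda>h. word_sum y (block_word (\<lambda>_. i h) (\<lambda>_. j h) (F h))) H =
    word_sum y (block_word a b (\<Union>h\<in>H. F h))"
  using assms(1,2,5,7)
proof (induction H rule: finite_ne_induct)
  case (singleton h)
  then show ?case
    using assms(3,4) by (auto simp: sgsum_singleton intro!: word_sum_block_word_cong)
next
  case (insert h H)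
  have "F h \<inter> F h' = {}" if "h' \<in> H" for h'
    using assms(6)[of h h'] insert.hyps(3) that by auto
  then have "F h \<inter> (\<Union>h\<in>H. F h) = {}"
    by blast
  moreover have "word_sum y (block_word (\<lambda>_. i h) (\<lambda>_. j h) (F h)) = word_sum y (block_word a b (F h))"
    using insert.prems(2)[of h] insert.prems(1)[of h] assms(3,4)
    by (intro word_sum_block_word_cong) simp_all
  moreover have "sgsum (\<lambda>h. word_sum y (block_word (\<lambda>_. i h) (\<lambda>_. j h) (F h))) H =
      word_sum y (block_word a b (\<Union>h\<in>H. F h))"
    using insert.prems by (intro insert.IH) simp_all
  moreover have "finite (\<Union>h\<in>H. F h)" "(\<Union>h\<in>H. F h) \<noteq> {}"
    using insert.hyps assms(3,4) by auto
  ultimately show ?case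
    using insert.hyps assms(3,4) by (simp add: sgsum_insert word_sum_block_word_Un)
qed

text \<open>With the same letters at every \<open>t\<close>, the sum falls into the three summands
  prescribed by \<open>variable_word_sums\<close>.\<close>

lemma word_sum_variable_word:
  assumes "finite F" "F \<noteq> {}" "F \<subseteq> {1..}"
  shows "word_sum y (block_word (\<lambda>_. i) (\<lambda>_. j) F) =
    sgsum (\<lambda>t. y (sgn t) t) (neg_consts F \<union> pos_consts F) +
    sgsum (\<lambda>t. y (int i) t) (pos_vars F) + sgsum (\<lambda>t. y (- int j) t) (neg_vars F)"
proof -
  let ?f = "\<lambda>p. y (block_letter (\<lambda>_. i) (\<lambda>_. j) p) p"
  have fin: "finite (neg_consts F \<union> pos_consts F)" "neg_consts F \<union> pos_consts F \<noteq> {}"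
    "finite (pos_vars F)" "pos_vars F \<noteq> {}" "finite (neg_vars F)" "neg_vars F \<noteq> {}"
    using assms by (auto simp: position_defs)
  have "word_sum y (block_word (\<lambda>_. i) (\<lambda>_. j) F) =
      sgsum ?f (neg_consts F \<union> pos_consts F \<union> pos_vars F \<union> neg_vars F)"
    using assms by (simp add: word_sum_block_word positions_def)
  also have "\<dots> = sgsum ?f (neg_consts F \<union> pos_consts F) + sgsum ?f (pos_vars F) +
      sgsum ?f (neg_vars F)"
  proof -
    \<comment> \<open>Constants sit at odd and variables at even positions; the two kinds of
      variable positions are separated by sign, since \<open>0\<close> is not in
      \<open>F\<close>.\<close>
    have "(neg_consts F \<union> pos_consts F) \<inter> pos_vars F = {}"
      "(neg_consts F \<union> pos_consts F \<union> pos_vars F) \<inter> neg_vars F = {}"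
      using assms(3) by (auto simp: position_defs) presburger+
    then show ?thesis
      using fin by (simp add: sgsum_Un_disjoint)
  qed
  also have "sgsum ?f (neg_consts F \<union> pos_consts F) = sgsum (\<lambda>t. y (sgn t) t) (neg_consts F \<union> pos_consts F)"
    using fin by (intro sgsum_cong) (auto simp: block_letter_def position_defs)
  also have "sgsum ?f (pos_vars F) = sgsum (\<lambda>t. y (int i) t) (pos_vars F)"
    using fin assms(3) by (intro sgsum_cong) (auto simp: block_letter_def position_defs)
  also have "sgsum ?f (neg_vars F) = sgsum (\<lambda>t. y (- int j) t) (neg_vars F)"
    using fin by (intro sgsum_cong) (auto simp: block_letter_def position_defs)
  finally show ?thesis .
qed

section \<open>Admissibility and composition of block words\<close>

lemma block_word_in_words:
  assumes "\<And>n. n \<noteq> 0 \<Longrightarrow> k n \<ge> 1" "finite F" "F \<noteq> {}" "F \<subseteq> {1..}"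
    and "\<And>t. t \<in> F \<Longrightarrow> a t \<in> {1..k (2 * int t)} \<and> b t \<in> {1..k (- 2 * int t)}"
  shows "block_word a b F \<in> words k"
proof -
  have k1: "1 \<le> int (k n)" if "n \<noteq> 0" for n
    using assms(1)[OF that] by simp
  have "admissible_letter k p (block_letter a b p)" if "p \<in> positions F" for p
    using that assms(4,5) k1[of p]
    by (auto simp: positions_def position_defs admissible_letter_def block_letter_def
        nat_mult_distrib)
  moreover have "0 \<notin> positions F"
    using assms(4) by (auto simp: positions_eq)
  ultimately show ?thesis
    unfolding words_def mem_Collect_eq dom_block_word
    using assms(2,3) by (auto simp: block_word_def)
qed

text \<open>Later blocks surround earlier ones, since every block has positions of both signs.\<close>

lemma R1_less_block_word:
  assumes "finite A" "A \<noteq> {}" "A \<subseteq> {1..}" "finite B" "B \<noteq> {}" "B \<subseteq> {1..}"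
    and less: "\<And>s t. s \<in> A \<Longrightarrow> t \<in> B \<Longrightarrow> s < t"
  shows "R1_less (block_word a b A) (block_word a b B)"
proof -
  let ?L = "neg_consts B \<union> neg_vars B" and ?R = "pos_consts B \<union> pos_vars B"
  have fin: "finite ?L" "?L \<noteq> {}" "finite ?R" "?R \<noteq> {}" "finite (positions A)" "positions A \<noteq> {}"
    using assms by (auto simp: position_defs)
  have "p < q" if "p \<in> ?L" "q \<in> positions A" for p q
    using that less by (fastforce simp: positions_def position_defs)
  then have "Max ?L < Min (positions A)"
    using fin by simp
  moreover have "p < q" if "p \<in> positions A" "q \<in> ?R" for p q
    using that less by (fastforce simp: positions_def position_defs)
  then have "Max (positions A) < Min ?R"
    using fin by simp
  moreover have "Min (positions A) \<le> Max (positions A)"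
    using fin by simp
  moreover have "positions B = ?L \<union> ?R"
    by (auto simp: positions_def)
  ultimately show ?thesis
    unfolding R1_less_def dom_block_word using fin by blast
qed

text \<open>Block words over separated index sets are admissible, related by \<open>R1_less\<close>,
  and concatenate to the block word of the union, so the law in \<open>word_system\<close>
  applies.\<close>

lemma word_system_block_word_Un:
  assumes k: "\<And>n. n \<noteq> 0 \<Longrightarrow> k n \<ge> 1" and T: "word_system y k T"
    and AB: "finite A" "A \<noteq> {}" "A \<subseteq> {1..}" "finite B" "B \<noteq> {}" "B \<subseteq> {1..}"
    and less: "\<And>s t. s \<in> A \<Longrightarrow> t \<in> B \<Longrightarrow> s < t"
    and ab: "\<And>t. t \<in> A \<union> B \<Longrightarrow> a t \<in> {1..k (2 * int t)} \<and> b t \<in> {1..k (- 2 * int t)}"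
  shows "T (word_sum y (block_word a b (A \<union> B))) =
    T (word_sum y (block_word a b A)) \<circ> T (word_sum y (block_word a b B))"
proof -
  have "block_word a b A \<in> words k" "block_word a b B \<in> words k"
    using k AB ab by (auto intro!: block_word_in_words)
  moreover have "R1_less (block_word a b A) (block_word a b B)"
    using AB less by (intro R1_less_block_word)
  ultimately show ?thesis
    using T unfolding word_system_def block_word_Un[symmetric] by simp
qed

text \<open>Positions move outward as \<open>t\<close> grows, so blocks in increasing order give all
  order conditions between consecutive stages. The letter function \<open>sgn\<close> serves the
  constants of every stage.\<close>

lemma variable_word_sums_block_word:
  assumes k: "\<And>n. n \<noteq> 0 \<Longrightarrow> k n \<ge> 1"
    and F: "\<And>n. n \<ge> 1 \<Longrightarrow> finite (F n) \<and> F n \<noteq> {} \<and> F n \<subseteq> {1..}"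
    and less: "\<And>n t t'. n \<ge> 1 \<Longrightarrow> t \<in> F n \<Longrightarrow> t' \<in> F (Suc n) \<Longrightarrow> t < t'"
  shows "variable_word_sums y k (\<lambda>n i j. word_sum y (block_word (\<lambda>_. i) (\<lambda>_. j) (F n)))"
  unfolding variable_word_sums_def
proof (rule exI[of _ "\<lambda>n. neg_consts (F n)"], rule exI[of _ "\<lambda>n. pos_consts (F n)"],
    rule exI[of _ "\<lambda>n. neg_vars (F n)"], rule exI[of _ "\<lambda>n. pos_vars (F n)"],
    rule exI[of _ sgn], intro allI impI)
  fix n :: nat assume n: "1 \<le> n"
  have fin: "finite (neg_consts (F n))" "finite (pos_consts (F n))" "finite (neg_vars (F n))"
    "finite (pos_vars (F n))" and ne: "neg_consts (F n) \<noteq> {}" "pos_consts (F n) \<noteq> {}"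
    "neg_vars (F n) \<noteq> {}" "pos_vars (F n) \<noteq> {}" if "1 \<le> n" for n
    using F[OF that] by (auto simp: position_defs)
  have n': "1 \<le> n + 1" by simp
  have sgn: "neg_consts (F n) \<subseteq> {..<0}" "pos_consts (F n) \<subseteq> {0<..}"
    "neg_vars (F n) \<subseteq> {..<0}" "pos_vars (F n) \<subseteq> {0<..}"
    using F[OF n] by (auto simp: position_defs)
  have "(neg_consts (F n) \<union> pos_consts (F n)) \<inter> (neg_vars (F n) \<union> pos_vars (F n)) = {}"
  proof -
    have "odd p" if "p \<in> neg_consts (F n) \<union> pos_consts (F n)" for p
      using that by (auto simp: position_defs)
    moreover have "even p" if "p \<in> neg_vars (F n) \<union> pos_vars (F n)" for p
      using that by (auto simp: position_defs)
    ultimately show ?thesis by blast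
  qed
  moreover have "\<forall>t\<in>neg_consts (F n) \<union> pos_consts (F n). admissible_letter k t (sgn t)"
  proof
    fix t assume "t \<in> neg_consts (F n) \<union> pos_consts (F n)"
    then have "t \<noteq> 0" using sgn by auto
    then show "admissible_letter k t (sgn t)"
      using k[of t] by (auto simp: admissible_letter_def sgn_if)
  qed
  moreover have "Max (neg_consts (F (n + 1))) < Min (neg_consts (F n))"
    "Max (pos_consts (F n)) < Min (pos_consts (F (n + 1)))"
    "Max (pos_vars (F n)) < Min (pos_vars (F (n + 1)))"
    "Max (neg_vars (F (n + 1))) < Min (neg_vars (F n))"
    using fin[OF n] ne[OF n] fin[OF n'] ne[OF n'] less[OF n]
    by (simp_all, unfold position_defs) fastforce+
  moreover have "Min (neg_consts (F n)) < Max (pos_consts (F n))"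
  proof -
    have "Min (neg_consts (F n)) < 0" "0 < Max (pos_consts (F n))"
      using sgn(1,2) Min_in[OF fin(1)[OF n] ne(1)[OF n]] Max_in[OF fin(2)[OF n] ne(2)[OF n]]
      by auto
    then show ?thesis by simp
  qed
  moreover have "\<forall>i\<in>{1..k (int n)}. \<forall>j\<in>{1..k (- int n)}.
      word_sum y (block_word (\<lambda>_. i) (\<lambda>_. j) (F n)) =
        sgsum (\<lambda>t. y (sgn t) t) (neg_consts (F n) \<union> pos_consts (F n)) +
        sgsum (\<lambda>t. y (int i) t) (pos_vars (F n)) + sgsum (\<lambda>t. y (- int j) t) (neg_vars (F n))"
    using F[OF n] by (simp add: word_sum_variable_word)
  ultimately show "finite (neg_consts (F n)) \<and> neg_consts (F n) \<noteq> {} \<and> neg_consts (F n) \<subseteq> {..<0} \<and>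
    finite (pos_consts (F n)) \<and> pos_consts (F n) \<noteq> {} \<and> pos_consts (F n) \<subseteq> {0<..} \<and>
    finite (neg_vars (F n)) \<and> neg_vars (F n) \<noteq> {} \<and> neg_vars (F n) \<subseteq> {..<0} \<and>
    finite (pos_vars (F n)) \<and> pos_vars (F n) \<noteq> {} \<and> pos_vars (F n) \<subseteq> {0<..} \<and>
    (neg_consts (F n) \<union> pos_consts (F n)) \<inter> (neg_vars (F n) \<union> pos_vars (F n)) = {} \<and>
    (\<forall>t\<in>neg_consts (F n) \<union> pos_consts (F n). admissible_letter k t (sgn t)) \<and>
    Max (neg_consts (F (n + 1))) < Min (neg_consts (F n)) \<and>
    Min (neg_consts (F n)) < Max (pos_consts (F n)) \<and>
    Max (pos_consts (F n)) < Min (pos_consts (F (n + 1))) \<and>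
    Max (pos_vars (F n)) < Min (pos_vars (F (n + 1))) \<and>
    Max (neg_vars (F (n + 1))) < Min (neg_vars (F n)) \<and>
    (\<forall>i\<in>{1..k (int n)}. \<forall>j\<in>{1..k (- int n)}.
      word_sum y (block_word (\<lambda>_. i) (\<lambda>_. j) (F n)) =
        sgsum (\<lambda>t. y (sgn t) t) (neg_consts (F n) \<union> pos_consts (F n)) +
        sgsum (\<lambda>t. y (int i) t) (pos_vars (F n)) + sgsum (\<lambda>t. y (- int j) t) (neg_vars (F n)))"
    using sgn fin[OF n] ne[OF n] by (intro conjI)
qed

subsection \<open>Recurrent points\<close>

text \<open>The minimal set \<open>M\<close> stays a parameter: existence uses an arbitrary one,
  density the whole space.\<close>

locale recurrence_setup =
  fixes y :: "int \<Rightarrow> int \<Rightarrow> 's::ab_semigroup_add"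
    and k :: "int \<Rightarrow> nat"
    and m :: nat
    and T :: "nat \<Rightarrow> 's \<Rightarrow> 'x::metric_space \<Rightarrow> 'x"
    and G :: "('x \<Rightarrow> 'x) set"
    and M :: "'x set"
  assumes k_pos: "\<And>n. n \<noteq> 0 \<Longrightarrow> k n \<ge> 1"
    and k_mono_pos: "mono_on {1..} k"
    and k_mono_neg: "mono_on {1..} (\<lambda>n. k (- n))"
    and compact_X: "compact (UNIV :: 'x set)"
    and systems: "\<And>l. l \<in> {1..m} \<Longrightarrow> word_system y k (T l)"
    and G_group: "comm_homeo_group G"
    and T_in_G: "\<And>l s. l \<in> {1..m} \<Longrightarrow> T l s \<in> G"
    and minimal_M: "minimal_set G M"
begin

abbreviation bs :: "(nat \<Rightarrow> nat) \<Rightarrow> (nat \<Rightarrow> nat) \<Rightarrow> nat set \<Rightarrow> 's" where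
  "bs a b F \<equiv> word_sum y (block_word a b F)"

text \<open>By monotonicity of both halves of \<open>k\<close>, a letter allowed at stage
  \<open>n\<close> is allowed at every variable position with index \<open>t \<ge> n\<close>. For
  this reason the block of stage \<open>n\<close> is taken inside \<open>{n..}\<close>.\<close>

lemma k_le:
  assumes "1 \<le> n" "n \<le> t"
  shows "k (int n) \<le> k (2 * int t)" "k (- int n) \<le> k (- 2 * int t)"
  using assms mono_onD[OF k_mono_pos, of "int n" "2 * int t"]
    mono_onD[OF k_mono_neg, of "int n" "2 * int t"] by auto

lemma ip_system_block_word:
  assumes "l \<in> {1..m}" "1 \<le> n" "n \<le> L" "i \<in> {1..k (int n)}" "j \<in> {1..k (- int n)}"
  shows "ip_system G L (\<lambda>F. T l (bs (\<lambda>_. i) (\<lambda>_. j) F))"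
  unfolding ip_system_def
proof (intro conjI allI impI)
  fix A B :: "nat set"
  assume *: "finite A \<and> A \<noteq> {} \<and> finite B \<and> B \<noteq> {} \<and> A \<subseteq> {L..} \<and> B \<subseteq> {L..} \<and>
    (\<forall>a\<in>A. \<forall>b\<in>B. a < b)"
  have "i \<in> {1..k (2 * int t)} \<and> j \<in> {1..k (- 2 * int t)}" if "t \<in> A \<union> B" for t
  proof -
    have "n \<le> t" using * assms(3) that by auto
    then show ?thesis
      using assms(4,5) k_le[OF assms(2), of t] by auto
  qed
  moreover have "A \<subseteq> {1..}" "B \<subseteq> {1..}"
    using * assms(2,3) by auto
  ultimately show "T l (bs (\<lambda>_. i) (\<lambda>_. j) (A \<union> B)) =
      T l (bs (\<lambda>_. i) (\<lambda>_. j) A) \<circ> T l (bs (\<lambda>_. i) (\<lambda>_. j) B)"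
    using * by (intro word_system_block_word_Un[OF k_pos systems[OF assms(1)]]) auto
qed (use T_in_G assms in auto)

text \<open>There is one IP system for each triple \<open>(l, i, j)\<close>, hence finitely many,
  and the recurrence theorem returns them all with a common block. Continuity then enlarges the
  point found to a ball.\<close>

lemma recurrence_step:
  assumes "open V" "V \<inter> M \<noteq> {}" "1 \<le> n" "n \<le> L" "e > 0"
  shows "\<exists>F V' c. finite F \<and> F \<noteq> {} \<and> F \<subseteq> {L..} \<and> open V' \<and> V' \<inter> M \<noteq> {} \<and> closure V' \<subseteq> V \<and>
    V' \<subseteq> ball c e \<and> (\<forall>l\<in>{1..m}. \<forall>i\<in>{1..k (int n)}. \<forall>j\<in>{1..k (- int n)}. \<forall>x\<in>V'.
      T l (bs (\<lambda>_. i) (\<lambda>_. j) F) x \<in> V)"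
proof -
  define I where "I = {1..m} \<times> {1..k (int n)} \<times> {1..k (- int n)}"
  define P where "P = (\<lambda>(l, i, j) F. T l (bs (\<lambda>_. i) (\<lambda>_. j) F))"
  have "finite I" by (simp add: I_def)
  moreover have ip: "ip_system G L (P a)" if "a \<in> I" for a
    using that ip_system_block_word[OF _ assms(3,4)] by (auto simp: I_def P_def)
  ultimately have "\<exists>F. finite F \<and> F \<noteq> {} \<and> F \<subseteq> {L..} \<and> (\<exists>x\<in>V \<inter> M. \<forall>a\<in>I. P a F x \<in> V)"
    using assms(1,2) by (intro ip_recurrence[OF compact_X G_group minimal_M])
  then obtain F x where F: "finite F" "F \<noteq> {}" "F \<subseteq> {L..}" and x: "x \<in> V" "x \<in> M"
    and P: "\<And>a. a \<in> I \<Longrightarrow> P a F x \<in> V" by blast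
  define W where "W = V \<inter> (\<Inter>a\<in>I. P a F -` V)"
  have "continuous_on UNIV (P a F)" if "a \<in> I" for a
    using ip[OF that] comm_homeo_groupD(4)[OF G_group] by (simp add: ip_system_def)
  then have "open W"
    unfolding W_def using \<open>finite I\<close> assms(1) by (intro open_Int open_INT ballI open_vimage)
  moreover have "x \<in> W" using x P by (simp add: W_def)
  ultimately obtain d where d: "d > 0" "cball x d \<subseteq> W"
    by (meson open_contains_cball)
  \<comment> \<open>The radius \<open>d\<close> keeps the closure inside \<open>W\<close>, while
    \<open>e\<close> forces the sets to shrink during the iteration.\<close>
  define V' where "V' = ball x (min d e)"
  have "closure V' \<subseteq> cball x d"
    unfolding V'_def by (rule closure_minimal) auto
  then have V': "closure V' \<subseteq> W" "V' \<subseteq> W"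
    using d(2) closure_subset[of V'] by auto
  have "T l (bs (\<lambda>_. i) (\<lambda>_. j) F) z \<in> V"
    if "l \<in> {1..m}" "i \<in> {1..k (int n)}" "j \<in> {1..k (- int n)}" "z \<in> V'" for l i j z
  proof -
    have "(l, i, j) \<in> I" using that by (simp add: I_def)
    then have "P (l, i, j) F z \<in> V" using that(4) V'(2) unfolding W_def by blast
    then show ?thesis by (simp add: P_def)
  qed
  moreover have "x \<in> V' \<inter> M" "V' \<subseteq> ball x e" "open V'"
    using x d(1) assms(5) by (auto simp: V'_def)
  moreover have "closure V' \<subseteq> V" using V'(1) by (auto simp: W_def)
  ultimately show ?thesis
    using F by (intro exI[of _ F] exI[of _ V'] exI[of _ x]) blast
qed

section \<open>Nested neighbourhoods and their common point\<close>

lemma nested_neighbourhoods: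
  assumes "open U" "U \<inter> M \<noteq> {}"
  obtains F V where
    "\<And>n. finite (F n)" "\<And>n. F n \<noteq> {}" "\<And>n. F n \<subseteq> {n..}"
    "\<And>n t t'. t \<in> F n \<Longrightarrow> t' \<in> F (Suc n) \<Longrightarrow> t < t'"
    "\<And>n. V n \<noteq> {}" "V 0 = U" "\<And>n. closure (V (Suc n)) \<subseteq> V n"
    "\<And>n. \<exists>c. V (Suc n) \<subseteq> ball c (1 / real (Suc n))"
    "\<And>n l i j x. l \<in> {1..m} \<Longrightarrow> i \<in> {1..k (int (Suc n))} \<Longrightarrow> j \<in> {1..k (- int (Suc n))} \<Longrightarrow>
      x \<in> V (Suc n) \<Longrightarrow> T l (bs (\<lambda>_. i) (\<lambda>_. j) (F (Suc n))) x \<in> V n"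
proof -
  define good where "good = (\<lambda>n (F :: nat set, V). finite F \<and> F \<noteq> {} \<and> F \<subseteq> {n..} \<and> open V \<and>
    V \<inter> M \<noteq> {} \<and> (n = 0 \<longrightarrow> V = U))"
  define nxt where "nxt = (\<lambda>n (F :: nat set, V) (F', V'). (\<forall>t\<in>F. \<forall>t'\<in>F'. t < t') \<and> closure V' \<subseteq> V \<and>
    (\<exists>c. V' \<subseteq> ball c (1 / real (Suc n))) \<and>
    (\<forall>l\<in>{1..m}. \<forall>i\<in>{1..k (int (Suc n))}. \<forall>j\<in>{1..k (- int (Suc n))}. \<forall>x\<in>V'.
      T l (bs (\<lambda>_. i) (\<lambda>_. j) F') x \<in> V))"
  have "\<exists>f. \<forall>n. good n (f n) \<and> nxt n (f n) (f (Suc n))"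
  proof (rule dependent_nat_choice)
    \<comment> \<open>The block \<open>{0}\<close> is a placeholder that lets the iteration start at
      \<open>U\<close>; the first map, from \<open>V 1\<close> to \<open>V 0\<close>, is given by
      \<open>F 1\<close>.\<close>
    have "good 0 ({0}, U)" using assms by (simp add: good_def)
    then show "\<exists>q. good 0 q" ..
  next
    fix q n assume q: "good n q"
    obtain F V where [simp]: "q = (F, V)" by (cases q)
    have F: "F \<noteq> {}" "finite F" "F \<subseteq> {n..}" and V: "open V" "V \<inter> M \<noteq> {}"
      using q by (auto simp: good_def)
    \<comment> \<open>The bound \<open>Suc (Max F)\<close> puts the new block after \<open>F\<close>
      and inside \<open>{Suc n..}\<close>, where the letters of stage \<open>Suc n\<close> are
      admissible.\<close>
    have "Suc n \<le> Suc (Max F)"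
      using Max_in[OF F(2,1)] F(3) by auto
    from recurrence_step[OF V _ this, of "1 / real (Suc n)"] obtain F' V' c where
      F': "finite F'" "F' \<noteq> {}" "F' \<subseteq> {Suc (Max F)..}" "open V'" "V' \<inter> M \<noteq> {}" "closure V' \<subseteq> V"
      "V' \<subseteq> ball c (1 / real (Suc n))"
      "\<forall>l\<in>{1..m}. \<forall>i\<in>{1..k (int (Suc n))}. \<forall>j\<in>{1..k (- int (Suc n))}. \<forall>x\<in>V'.
        T l (bs (\<lambda>_. i) (\<lambda>_. j) F') x \<in> V"
      by auto
    have "\<forall>t\<in>F. \<forall>t'\<in>F'. t < t'"
      using F'(3) Max_ge[OF F(2)] by (fastforce simp: Suc_le_eq)
    then have "nxt n q (F', V')"
      unfolding nxt_def using F'(6-8) by (simp only: \<open>q = (F, V)\<close> prod.case) blast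
    moreover have "good (Suc n) (F', V')"
      using F' \<open>Suc n \<le> Suc (Max F)\<close> by (auto simp: good_def)
    ultimately show "\<exists>q'. good (Suc n) q' \<and> nxt n q q'" by blast
  qed
  then obtain f where f: "\<And>n. good n (f n)" "\<And>n. nxt n (f n) (f (Suc n))" by blast
  define F V where "F = (\<lambda>n. fst (f n))" and "V = (\<lambda>n. snd (f n))"
  have fn: "f n = (F n, V n)" for n
    by (simp add: F_def V_def)
  show thesis
  proof (rule that[of F V])
    show "finite (F n)" "F n \<noteq> {}" "F n \<subseteq> {n..}" "V n \<noteq> {}" for n
      using f(1)[of n] by (auto simp: good_def fn)
    show "V 0 = U"
      using f(1)[of 0] by (simp add: good_def fn)
    show "t < t'" if "t \<in> F n" "t' \<in> F (Suc n)" for n t t'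
      using f(2)[of n] that by (simp add: nxt_def fn)
    show "closure (V (Suc n)) \<subseteq> V n" "\<exists>c. V (Suc n) \<subseteq> ball c (1 / real (Suc n))" for n
      using f(2)[of n] by (simp_all add: nxt_def fn)
    show "T l (bs (\<lambda>_. i) (\<lambda>_. j) (F (Suc n))) x \<in> V n"
      if "l \<in> {1..m}" "i \<in> {1..k (int (Suc n))}" "j \<in> {1..k (- int (Suc n))}" "x \<in> V (Suc n)"
      for n l i j x
      using f(2)[of n] that unfolding nxt_def fn prod.case by blast
  qed
qed

text \<open>
  The largest index acts first: \<open>T l (s N)\<close> maps \<open>V N\<close> into \<open>V (N - 1)\<close>, so a sum over \<open>H\<close>
  maps \<open>V N\<close> down to \<open>V n\<close> for every \<open>n < Min H\<close>.
\<close>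

lemma sum_maps_nested:
  assumes F: "\<And>n. finite (F n)" "\<And>n. F n \<noteq> {}" "\<And>n. F n \<subseteq> {n..}"
    and F_Suc: "\<And>n t t'. t \<in> F n \<Longrightarrow> t' \<in> F (Suc n) \<Longrightarrow> t < t'"
    and V_Suc: "\<And>n. V (Suc n) \<subseteq> V n"
    and maps: "\<And>n l i j x. l \<in> {1..m} \<Longrightarrow> i \<in> {1..k (int (Suc n))} \<Longrightarrow>
      j \<in> {1..k (- int (Suc n))} \<Longrightarrow>
      x \<in> V (Suc n) \<Longrightarrow> T l (bs (\<lambda>_. i) (\<lambda>_. j) (F (Suc n))) x \<in> V n"
    and l: "l \<in> {1..m}"
    and ij: "\<And>n. n \<ge> 1 \<Longrightarrow> i n \<in> {1..k (int n)} \<and> j n \<in> {1..k (- int n)}"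
    and H: "H \<noteq> {}" "H \<subseteq> {Suc n..N}" and x: "x \<in> V N"
  shows "T l (sgsum (\<lambda>h. bs (\<lambda>_. i h) (\<lambda>_. j h) (F h)) H) x \<in> V n"
  using H x
proof (induction N arbitrary: H x)
  case (Suc N)
  have F_less: "t < t'" if "h < h'" "t \<in> F h" "t' \<in> F h'" for h h' t t'
    by (rule consecutive_less[of F, OF F(2) F_Suc _ that(2,3)]) (use that(1) in simp_all)
  have anti: "V N' \<subseteq> V n'" if "n' \<le> N'" for n' N'
    using V_Suc that by (rule lift_Suc_antimono_le)
  show ?case
  proof (cases "Suc N \<in> H")
    case False
    then have "H \<subseteq> {Suc n..N}" using Suc.prems(2) by (auto simp: le_Suc_eq)
    then show ?thesis using Suc V_Suc by blast
  next
    case True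
    define H' where "H' = H - {Suc N}"
    have H': "H = insert (Suc N) H'" "Suc N \<notin> H'" "H' \<subseteq> {Suc n..N}"
      using True Suc.prems(2) by (auto simp: H'_def le_Suc_eq)
    then have finH: "finite H'" "n \<le> N"
      using finite_subset True Suc.prems(2) by auto
    have step: "T l (bs (\<lambda>_. i (Suc N)) (\<lambda>_. j (Suc N)) (F (Suc N))) x \<in> V N"
      using maps[OF l] ij[of "Suc N"] Suc.prems(3) by simp
    show ?thesis
    proof (cases "H' = {}")
      case True
      then show ?thesis using step H' anti[OF finH(2)] by (auto simp: sgsum_singleton)
    next
      case False
      \<comment> \<open>Disjointness of the blocks makes the index of the block containing
        \<open>t\<close> well defined; it turns choices made per block into letters assigned to each
        \<open>t\<close>.\<close>
      define idx where "idx t = (THE h. t \<in> F h)" for t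
      have "F h \<inter> F h' = {}" if "h < h'" for h h'
        by (auto dest: F_less[OF that])
      then have disj: "F h \<inter> F h' = {}" if "h \<noteq> h'" for h h'
        using that by (metis inf_commute linorder_neqE_nat)
      have idx: "idx t = h" if "t \<in> F h" for t h
        unfolding idx_def using that disj by (intro the_equality) auto
      have H1: "h \<ge> 1" if "h \<in> H" for h
        using that Suc.prems(2) by auto
      have F1: "F h \<subseteq> {1..}" if "h \<in> H" for h
        using F(3)[of h] H1[OF that] by auto
      let ?bs = "bs (\<lambda>t. i (idx t)) (\<lambda>t. j (idx t))"
      have sum_eq: "sgsum (\<lambda>h. bs (\<lambda>_. i h) (\<lambda>_. j h) (F h)) K = ?bs (\<Union>h\<in>K. F h)"
        if K: "K \<subseteq> H" "K \<noteq> {}" for K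
      proof (rule word_sum_block_word_UN)
        show "finite K"
          using K(1) H'(1) finH(1) by (simp add: finite_subset)
        show "F h \<subseteq> {1..}" if "h \<in> K" for h
          using F1 K(1) that by blast
      qed (use K(2) F(1,2) disj idx in simp_all)
      have adm: "i (idx t) \<in> {1..k (2 * int t)} \<and> j (idx t) \<in> {1..k (- 2 * int t)}"
        if t: "t \<in> (\<Union>h\<in>H'. F h) \<union> F (Suc N)" for t
      proof -
        obtain h where h: "h \<in> H" "t \<in> F h" using t H'(1) by auto
        then have "h \<le> t" using F(3) by auto
        then show ?thesis
          using k_le[OF H1[OF h(1)], of t] ij[OF H1[OF h(1)]] idx[OF h(2)] by auto
      qed
      \<comment> \<open>The last block is split off: it acts first and moves \<open>x\<close> into
        \<open>V N\<close>, where the induction hypothesis for \<open>H'\<close> takes over.\<close>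
      have "T l (?bs ((\<Union>h\<in>H'. F h) \<union> F (Suc N))) = T l (?bs (\<Union>h\<in>H'. F h)) \<circ> T l (?bs (F (Suc N)))"
      proof (rule word_system_block_word_Un[OF k_pos systems[OF l]])
        show "(\<Union>h\<in>H'. F h) \<noteq> {}" using False F(2) by auto
        show "(\<Union>h\<in>H'. F h) \<subseteq> {1..}" "F (Suc N) \<subseteq> {1..}"
          using F1 H'(1) by blast+
        show "s < t" if st: "s \<in> (\<Union>h\<in>H'. F h)" "t \<in> F (Suc N)" for s t
        proof -
          obtain h where "h \<in> H'" "s \<in> F h" using st(1) by blast
          then show ?thesis using F_less[of h "Suc N" s t] H'(3) st(2) by auto
        qed
      qed (use F(1,2) finH(1) adm in auto)
      moreover have "(\<Union>h\<in>H. F h) = (\<Union>h\<in>H'. F h) \<union> F (Suc N)"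
        using H'(1) by auto
      moreover have "T l (?bs (F (Suc N))) x \<in> V N"
        using step sum_eq[of "{Suc N}"] True by (simp add: sgsum_singleton)
      moreover have "H' \<subseteq> H"
        using H'(1) by blast
      ultimately show ?thesis
        using Suc.IH[OF False H'(3)] sum_eq[OF subset_refl Suc.prems(1)] sum_eq[OF _ False] by simp
    qed
  qed
qed simp

text \<open>The nested sets have a common point by compactness. Sums over late stages map deep sets
  into a small \<open>V (Suc n)\<close>, with a threshold depending on the radius and not on the
  choices, which makes the limit uniform.\<close>

lemma recurrent_point_in_open:
  assumes "open U" "U \<inter> M \<noteq> {}"
  shows "\<exists>x0\<in>U. x0 \<in> R1_recurrent_points y k m T"
proof -
  obtain F V where F: "\<And>n. finite (F n)" "\<And>n. F n \<noteq> {}" "\<And>n. F n \<subseteq> {n..}"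
    and F_Suc: "\<And>n t t'. t \<in> F n \<Longrightarrow> t' \<in> F (Suc n) \<Longrightarrow> t < t'"
    and V: "\<And>n. V n \<noteq> {}" "V 0 = U" "\<And>n. closure (V (Suc n)) \<subseteq> V n"
    and small: "\<And>n. \<exists>c. V (Suc n) \<subseteq> ball c (1 / real (Suc n))"
    and maps: "\<And>n l i j x. l \<in> {1..m} \<Longrightarrow> i \<in> {1..k (int (Suc n))} \<Longrightarrow>
      j \<in> {1..k (- int (Suc n))} \<Longrightarrow>
      x \<in> V (Suc n) \<Longrightarrow> T l (bs (\<lambda>_. i) (\<lambda>_. j) (F (Suc n))) x \<in> V n"
    using nested_neighbourhoods[OF assms] by metis
  have V_Suc: "V (Suc n) \<subseteq> V n" for n
    using V(3)[of n] closure_subset[of "V (Suc n)"] by blast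
  have "UNIV \<inter> (\<Inter>n. closure (V n)) \<noteq> {}"
  proof (rule compact_imp_fip_image[OF compact_X])
    fix K :: "nat set" assume K: "finite K"
    have "V (Max K) \<subseteq> closure (V n)" if "n \<in> K" for n
      using lift_Suc_antimono_le[of V, OF V_Suc Max_ge[OF K that]] closure_subset[of "V n"] by blast
    then show "UNIV \<inter> (\<Inter>n\<in>K. closure (V n)) \<noteq> {}"
      using V(1)[of "Max K"] by blast
  qed simp
  then obtain x0 where "x0 \<in> closure (V n)" for n
    by blast
  then have x0: "x0 \<in> V n" for n
    using V(3)[of n] by blast
  define s where "s = (\<lambda>n i j. bs (\<lambda>_. i) (\<lambda>_. j) (F n))"
  have "variable_word_sums y k s"
    unfolding s_def
  proof (rule variable_word_sums_block_word[OF k_pos])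
    show "finite (F n) \<and> F n \<noteq> {} \<and> F n \<subseteq> {1..}" if "n \<ge> 1" for n
      using F(1,2)[of n] F(3)[of n] that by auto
  qed (use F_Suc in auto)
  moreover have "R1_lim_uniformly (choice_sequences k s) (\<lambda>s. T l s x0) x0" if l: "l \<in> {1..m}" for l
    unfolding R1_lim_uniformly_def
  proof (intro allI impI)
    fix O' assume "open O' \<and> x0 \<in> O'"
    then obtain e where e: "e > 0" "ball x0 e \<subseteq> O'"
      by (meson open_contains_ball)
    obtain n where n: "1 / real (Suc n) < e / 2"
      using e(1) by (metis half_gt_zero nat_approx_posE)
    obtain c where c: "V (Suc n) \<subseteq> ball c (1 / real (Suc n))"
      using small by blast
    have sub: "V (Suc n) \<subseteq> O'"
    proof
      fix z assume "z \<in> V (Suc n)"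
      then have "dist c z < e / 2" "dist c x0 < e / 2"
        using c x0[of "Suc n"] n by (force simp: less_trans)+
      then have "dist x0 z < e"
        using dist_triangle2[of x0 z c] by (simp add: dist_commute)
      then show "z \<in> O'" using e(2) by auto
    qed
    \<comment> \<open>Sums over indices from \<open>Suc (Suc n)\<close> on land in
      \<open>V (Suc n)\<close>; one index later than the target set, since stage \<open>h\<close>
      maps \<open>V h\<close> into \<open>V (h - 1)\<close>.\<close>
    have "T l q x0 \<in> O'" if f: "f \<in> choice_sequences k s" and q: "q \<in> FS f {Suc (Suc n)..}" for f q
    proof -
      obtain i j where f_eq: "f = (\<lambda>n. s n (i n) (j n))"
        and ij: "\<And>n. n \<ge> 1 \<Longrightarrow> i n \<in> {1..k (int n)} \<and> j n \<in> {1..k (- int n)}"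
        using f unfolding choice_sequences_def by blast
      obtain H where H: "finite H" "H \<noteq> {}" "H \<subseteq> {Suc (Suc n)..}" "q = sgsum f H"
        using q unfolding FS_def by blast
      have HN: "H \<subseteq> {Suc (Suc n)..Max H}"
        using H(1,3) by auto
      \<comment> \<open>\<open>Max H\<close> can serve as the starting level because
        \<open>x0\<close> lies in every \<open>V n\<close>.\<close>
      have "T l (sgsum (\<lambda>h. bs (\<lambda>_. i h) (\<lambda>_. j h) (F h)) H) x0 \<in> V (Suc n)"
        by (rule sum_maps_nested[where F = F and V = V and i = i and j = j and N = "Max H"])
          (fact F F_Suc V_Suc maps l ij H(2) HN x0)+
      then show ?thesis
        using sub H(4) by (auto simp: f_eq s_def)
    qed
    then show "\<exists>n0\<ge>1. \<forall>x\<in>choice_sequences k s. \<forall>q\<in>FS x {n0..}. T l q x0 \<in> O'"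
      by (intro exI[of _ "Suc (Suc n)"]) auto
  qed
  ultimately have "x0 \<in> R1_recurrent_points y k m T"
    unfolding R1_recurrent_points_def by blast
  then show ?thesis
    using x0[of 0] V(2) by blast
qed

end

section \<open>Existence and density of recurrent points\<close>

theorem theorem3p7:
  fixes y :: "int \<Rightarrow> int \<Rightarrow> 's::ab_semigroup_add"
    and k :: "int \<Rightarrow> nat"
    and m :: nat
    and T :: "nat \<Rightarrow> 's \<Rightarrow> 'x::metric_space \<Rightarrow> 'x"
    and G :: "('x \<Rightarrow> 'x) set"
  assumes k_pos: "\<And>n. n \<noteq> 0 \<Longrightarrow> k n \<ge> 1"
    and k_mono_pos: "mono_on {1..} k"
    and k_mono_neg: "mono_on {1..} (\<lambda>n. k (- n))"
    and compact_X: "compact (UNIV :: 'x set)"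
    and m_pos: "m \<ge> 1"
    and systems: "\<And>l. l \<in> {1..m} \<Longrightarrow> word_system y k (T l)"
    and G_group: "comm_homeo_group G"
    and T_in_G: "\<And>l s. l \<in> {1..m} \<Longrightarrow> T l s \<in> G"
  shows "(\<exists>x0. x0 \<in> R1_recurrent_points y k m T) \<and>
         (minimal_action G \<longrightarrow> closure (R1_recurrent_points y k m T) = UNIV)"
proof -
  have rec: "recurrence_setup y k m T G M" if "minimal_set G M" for M
    using assms that by unfold_locales auto
  obtain M where M: "minimal_set G M"
    using minimal_set_exists[OF compact_X] by blast
  then have "\<exists>x0. x0 \<in> R1_recurrent_points y k m T"
    using recurrence_setup.recurrent_point_in_open[OF rec, of M UNIV]
    by (auto simp: minimal_set_def)
  moreover have "closure (R1_recurrent_points y k m T) = UNIV" if "minimal_action G"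
  proof -
    \<comment> \<open>For a minimal action \<open>UNIV\<close> is itself a minimal set, so every
      nonempty open \<open>U\<close> meets it and contains a recurrent point.\<close>
    have "\<exists>x0\<in>U. x0 \<in> R1_recurrent_points y k m T" if "open U" "U \<noteq> {}" for U
      using recurrence_setup.recurrent_point_in_open[OF rec[OF minimal_set_UNIV], of U] that
        \<open>minimal_action G\<close> by simp
    then show ?thesis
      by (auto simp: closure_iff_nhds_not_empty; blast)
  qed
  ultimately show ?thesis by blast
qed

end
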